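(* Let $N\ge 1$, let $\varepsilon>0$, and let $x_1<x_2<\cdots<x_N$ and $y_1<y_2<\cdots<y_N$ be real numbers. Let $\zeta$ be the dividing index of these meshes and let $K_L=[\check k_{ij}]\in\mathbb{R}^{N\times N}$ be the lower block induced by $\zeta$. Define the ratio vector $\boldsymbol r=(r_1,\dots,r_{N-1})\in\mathbb{R}^{N-1}$ by $$r_i=\frac{\check k_{i+1,1}}{\check k_{i,1}},\qquad i=1,\dots,N-1,$$ with the convention $r_i=1$ if $\check k_{i,1}=0$, and define the block-edge (row) vectors $$\boldsymbol\eta_i=[\check k_{i,\zeta(i-1)+1},\dots,\check k_{i,\zeta(i)}]\in\mathbb{R}^{\zeta(i)-\zeta(i-1)},\qquad i=1,\dots,N,$$ with the convention $\zeta(0)=0$ ($\boldsymbol\eta_i$ is empty when $\zeta(i)=\zeta(i-1)$). Then the vectors $\boldsymbol\eta_1,\dots,\boldsymbol\eta_N$ have a total of $\zeta(N)$ entries, and $K_L$ has the representation $$K_L=\begin{pmatrix}\boldsymbol\eta_1\\ r_1\boldsymbol\eta_1&\boldsymbol\eta_2\\ r_1r_2\boldsymbol\eta_1&r_2\boldsymbol\eta_2&\boldsymbol\eta_3\\ \vdots&\vdots&\vdots&\ddots\\ \prod_{t=1}^{N-1}r_t\,\boldsymbol\eta_1&\prod_{t=2}^{N-1}r_t\,\boldsymbol\eta_2&\cdots&\cdots&\boldsymbol\eta_N&\ \end{pmatrix},$$ where blank positions are zero. That is, for all $1\le i,s\le N$, the restriction of row $i$ of $K_L$ to the columns $\zeta(s-1)+1,\dots,\zeta(s)$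 equals $\bigl(\prod_{t=s}^{i-1}r_t\bigr)\boldsymbol\eta_s$ if $s\le i$ (empty product $=1$) and equals $0$ if $s>i$, and all columns of $K_L$ with index larger than $\zeta(N)$ are zero.
   Context: The dividing index of the sorted meshes $x_1<\cdots<x_N$, $y_1<\cdots<y_N$ is the map $\zeta:\{1,\dots,N\}\to\{0,1,\dots,N\}$ defined as follows: if $y_1\le x_i<y_N$, then $\zeta(i)$ is the unique index with $y_{\zeta(i)}\le x_i<y_{\zeta(i)+1}$; if $x_i<y_1$, then $\zeta(i)=0$; if $x_i\ge y_N$, then $\zeta(i)=N$. The kernel matrix is $K=[k_{ij}]\in\mathbb{R}^{N\times N}$ with $k_{ij}=e^{-|x_i-y_j|/\varepsilon}$. The lower block $K_L=[\check k_{ij}]\in\mathbb{R}^{N\times N}$ induced by $\zeta$ is defined by $\check k_{ij}=k_{ij}=e^{-(x_i-y_j)/\varepsilon}$ for $1\le j\le\zeta(i)$ and $\check k_{ij}=0$ for $\zeta(i)<j\le N$. *)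

theory Defs
  imports Complex_Main "Jordan_Normal_Form.Matrix"
begin

text \<open>
  Mesh points, the dividing index, the ratios and the block-edge vectors are indexed from 1, and a
  mesh \<open>x\<^sub>1, \<dots>, x\<^sub>N\<close> is a function whose values outside \<open>{1..N}\<close> are irrelevant.  The library's
  matrices and vectors are indexed from 0, so the entry in row \<open>i\<close> and column \<open>j\<close> of \<open>A\<close>, counted
  from 1, is \<open>A $$ (i - 1, j - 1)\<close>.
\<close>

text \<open>The value at \<open>i = 0\<close> is the convention \<open>\<zeta>(0) = 0\<close>.\<close>

definition dividing_index :: "nat \<Rightarrow> (nat \<Rightarrow> real) \<Rightarrow> (nat \<Rightarrow> real) \<Rightarrow> nat \<Rightarrow> nat" where
  "dividing_index N x y i =
    (if i = 0 then 0
     else if x i < y 1 then 0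
     else if y N \<le> x i then N
     else (THE k. k \<in> {1..<N} \<and> y k \<le> x i \<and> x i < y (k + 1)))"

definition kernel_mat :: "nat \<Rightarrow> real \<Rightarrow> (nat \<Rightarrow> real) \<Rightarrow> (nat \<Rightarrow> real) \<Rightarrow> real mat" where
  "kernel_mat N \<epsilon> x y = mat N N (\<lambda>(i, j). exp (- \<bar>x (i + 1) - y (j + 1)\<bar> / \<epsilon>))"

definition lower_block :: "nat \<Rightarrow> real \<Rightarrow> (nat \<Rightarrow> real) \<Rightarrow> (nat \<Rightarrow> real) \<Rightarrow> real mat" where
  "lower_block N \<epsilon> x y = mat N N (\<lambda>(i, j).
     if j + 1 \<le> dividing_index N x y (i + 1) then kernel_mat N \<epsilon> x y $$ (i, j) else 0)"

definition ratio_vec :: "real mat \<Rightarrow> real vec" where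
  "ratio_vec A = vec (dim_row A - 1)
     (\<lambda>i. if A $$ (i, 0) = 0 then 1 else A $$ (i + 1, 0) / A $$ (i, 0))"

text \<open>The restriction of row \<open>i\<close> to the columns \<open>a + 1, \<dots>, b\<close>, all counted from 1.\<close>

definition row_segment :: "'a mat \<Rightarrow> nat \<Rightarrow> nat \<Rightarrow> nat \<Rightarrow> 'a vec" where
  "row_segment A i a b = vec (b - a) (\<lambda>c. A $$ (i - 1, a + c))"

definition block_edge :: "real mat \<Rightarrow> (nat \<Rightarrow> nat) \<Rightarrow> nat \<Rightarrow> real vec" where
  "block_edge A \<zeta> i = row_segment A i (\<zeta> (i - 1)) (\<zeta> i)"

lemma dividing_index_ex1:
  fixes N :: nat and y :: "nat \<Rightarrow> real"
  assumes "strict_mono_on {1..N} y" and "y 1 \<le> z" and "z < y N" and "1 \<le> N"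
  shows "\<exists>!k. k \<in> {1..<N} \<and> y k \<le> z \<and> z < y (k + 1)"
proof -
  define M where "M = {k \<in> {1..N}. y k \<le> z}"
  have M: "finite M" "1 \<in> M" using assms by (auto simp: M_def)
  define m where "m = Max M"
  have "m \<in> M" using Max_in[of M] M unfolding m_def by blast
  moreover have "m \<noteq> N" using \<open>m \<in> M\<close> assms(3) by (auto simp: M_def)
  ultimately have m: "m \<in> {1..<N}" "y m \<le> z" by (auto simp: M_def)
  have "m + 1 \<notin> M" using Max_ge[OF M(1), of "m + 1"] by (auto simp: m_def)
  then have m2: "z < y (m + 1)" using m by (auto simp: M_def)
  show ?thesis
  proof (rule ex1I[of _ m])
    fix k assume k: "k \<in> {1..<N} \<and> y k \<le> z \<and> z < y (k + 1)"
    have le: "y a \<le> y b" if "a \<le> b" "a \<in> {1..N}" "b \<in> {1..N}" for a b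
      using strict_mono_on_leD[OF assms(1)] that by blast
    have "\<not> k + 1 \<le> m" using le[of "k + 1" m] k m by auto
    moreover have "\<not> m + 1 \<le> k" using le[of "m + 1" k] k m m2 by auto
    ultimately show "k = m" by simp
  qed (use m m2 in auto)
qed

lemma le_dividing_index_iff:
  assumes "strict_mono_on {1..N} y" and "i \<in> {1..N}" and "j \<in> {1..N}"
  shows "j \<le> dividing_index N x y i \<longleftrightarrow> y j \<le> x i"
proof -
  have le: "y a \<le> y b" if "a \<le> b" "a \<in> {1..N}" "b \<in> {1..N}" for a b
    using strict_mono_on_leD[OF assms(1)] that by blast
  consider "x i < y 1" | "y N \<le> x i" "y 1 \<le> x i" | "y 1 \<le> x i" "x i < y N" by linarith
  then show ?thesis
  proof cases
    case 1
    then show ?thesis using le[of 1 j] assms by (auto simp: dividing_index_def)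
  next
    case 2
    then show ?thesis using le[of j N] assms by (auto simp: dividing_index_def)
  next
    case 3
    define k where "k = (THE k. k \<in> {1..<N} \<and> y k \<le> x i \<and> x i < y (k + 1))"
    have k: "k \<in> {1..<N} \<and> y k \<le> x i \<and> x i < y (k + 1)"
      unfolding k_def using theI'[OF dividing_index_ex1[OF assms(1) 3]] assms by simp
    have "dividing_index N x y i = k" using 3 assms by (auto simp: dividing_index_def k_def)
    moreover have "j \<le> k \<longleftrightarrow> y j \<le> x i"
      using le[of j k] le[of "k + 1" j] k assms(3) by (cases "j \<le> k") auto
    ultimately show ?thesis by simp
  qed
qed

lemma lower_block_entry:
  assumes "strict_mono_on {1..N} y" and "i \<in> {1..N}" and "j \<in> {1..N}"
  shows "lower_block N \<epsilon> x y $$ (i - 1, j - 1) =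
    (if j \<le> dividing_index N x y i then exp (- (x i - y j) / \<epsilon>) else 0)"
  using le_dividing_index_iff[OF assms, of x] assms
  by (auto simp: lower_block_def kernel_mat_def diff_divide_distrib)

end

theory Submission
  imports Defs
begin

text \<open>
  On the support of the lower block the absolute value in the kernel disappears, so an entry
  factors as \<open>exp (- x\<^sub>i / \<epsilon>) * exp (y\<^sub>j / \<epsilon>)\<close>.  Hence consecutive rows are proportional there, and
  the factor can be read off the first column, which is nonzero in every row that has a nonzero
  entry at all.  Since \<open>\<zeta>\<close> is monotone, the columns of block \<open>s\<close> lie in the support of row \<open>i\<close>
  exactly when \<open>s \<le> i\<close>, and the lengths of the blocks telescope.
\<close>

lemma dividing_index_le:
  assumes "strict_mono_on {1..N} y" and "1 \<le> N"
  shows "dividing_index N x y i \<le> N"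
  using theI'[OF dividing_index_ex1[OF assms(1), of "x i"]] assms(2)
  by (auto simp: dividing_index_def not_less not_le)

text \<open>By \<open>le_dividing_index_iff\<close>, comparing \<open>k\<close> with an index value
  amounts to comparing mesh points, so the claim reduces to \<open>y k \<le> x i \<le> x j\<close>
  for \<open>k\<close> the value at \<open>i\<close>. That equivalence only covers indices in
  \<open>{1..N}\<close>, hence the separate case of value 0.\<close>

lemma dividing_index_mono:
  assumes "strict_mono_on {1..N} x" and "strict_mono_on {1..N} y"
    and "i \<le> j" and "j \<le> N"
  shows "dividing_index N x y i \<le> dividing_index N x y j"
proof (cases "i = 0 \<or> dividing_index N x y i = 0")
  case True
  then show ?thesis by (auto simp: dividing_index_def)
next
  case False
  define k where "k = dividing_index N x y i"
  have ij: "i \<in> {1..N}" "j \<in> {1..N}" using False assms(3,4) by auto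
  have k: "k \<in> {1..N}"
    using False dividing_index_le[OF assms(2)] ij by (auto simp: k_def Suc_le_eq)
  have "y k \<le> x i"
    using le_dividing_index_iff[OF assms(2) ij(1) k, of x] by (simp add: k_def)
  also have "\<dots> \<le> x j"
    using strict_mono_on_leD[OF assms(1) ij assms(3)] .
  finally show ?thesis
    using le_dividing_index_iff[OF assms(2) ij(2) k, of x] by (simp add: k_def)
qed

text \<open>A positive index at \<open>t\<close> puts column 1 in the support of rows
  \<open>t\<close> and \<open>Suc t\<close>. Both entries are then exponentials, the convention for
  a zero denominator does not apply, and \<open>y 1\<close> cancels in the quotient.\<close>

lemma ratio_vec_lower_block:
  assumes "strict_mono_on {1..N} x" and "strict_mono_on {1..N} y"
    and "t \<in> {1..<N}" and "1 \<le> dividing_index N x y t"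
  shows "ratio_vec (lower_block N \<epsilon> x y) $ (t - 1) = exp ((x t - x (Suc t)) / \<epsilon>)"
proof -
  let ?K = "lower_block N \<epsilon> x y"
  have "1 \<le> dividing_index N x y (Suc t)"
    using dividing_index_mono[OF assms(1,2), of t "Suc t"] assms(3,4) by auto
  then have "?K $$ (t, 0) = exp (- (x (Suc t) - y 1) / \<epsilon>)"
    using lower_block_entry[OF assms(2), of "Suc t" 1 \<epsilon> x] assms(3) by auto
  moreover have "?K $$ (t - 1, 0) = exp (- (x t - y 1) / \<epsilon>)"
    using lower_block_entry[OF assms(2), of t 1 \<epsilon> x] assms(3,4) by auto
  moreover have "dim_row ?K = N" by (simp add: lower_block_def)
  moreover have "t - 1 < N - 1" and "t - 1 + 1 = t" using assms(3) by auto
  ultimately show ?thesis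
    by (simp add: ratio_vec_def exp_diff[symmetric] diff_divide_distrib[symmetric])
qed

text \<open>The exponents telescope. Monotonicity carries the positivity of the index at
  \<open>s\<close> to every later row, so each factor is a genuine quotient.\<close>

lemma prod_ratio_vec_lower_block:
  assumes "strict_mono_on {1..N} x" and "strict_mono_on {1..N} y"
    and "1 \<le> s" and "s \<le> i" and "i \<le> N" and "1 \<le> dividing_index N x y s"
  shows "(\<Prod>t = s..<i. ratio_vec (lower_block N \<epsilon> x y) $ (t - 1)) = exp ((x s - x i) / \<epsilon>)"
  using assms(4,5)
proof (induction i rule: dec_induct)
  case base
  then show ?case by simp
next
  case (step i)
  have "1 \<le> dividing_index N x y i"
    using dividing_index_mono[OF assms(1,2), of s i] step assms(6) by auto
  then have "ratio_vec (lower_block N \<epsilon> x y) $ (i - 1) = exp ((x i - x (Suc i)) / \<epsilon>)"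
    using ratio_vec_lower_block[OF assms(1,2)] step assms(3) by auto
  then show ?case
    using step by (simp add: exp_add[symmetric] add_divide_distrib[symmetric])
qed

text \<open>Column \<open>j\<close> lies in the support of row \<open>s\<close>, hence in that of
  row \<open>i\<close>, and the quotient of the two exponentials does not depend on
  \<open>y j\<close>.\<close>

lemma lower_block_entry_eq_prod_ratio:
  assumes "strict_mono_on {1..N} x" and "strict_mono_on {1..N} y"
    and "1 \<le> s" and "s \<le> i" and "i \<le> N" and "1 \<le> j" and "j \<le> dividing_index N x y s"
  shows "lower_block N \<epsilon> x y $$ (i - 1, j - 1) =
    (\<Prod>t = s..<i. ratio_vec (lower_block N \<epsilon> x y) $ (t - 1)) * lower_block N \<epsilon> x y $$ (s - 1, j - 1)"
proof -
  have j: "j \<in> {1..N}"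
    using dividing_index_le[OF assms(2), of x s] assms(3-7) by auto
  have "j \<le> dividing_index N x y i"
    using dividing_index_mono[OF assms(1,2,4,5)] assms(7) by simp
  then have "lower_block N \<epsilon> x y $$ (i - 1, j - 1) = exp (- (x i - y j) / \<epsilon>)"
    using lower_block_entry[OF assms(2) _ j] assms(3-5) by auto
  also have "\<dots> = exp ((x s - x i) / \<epsilon>) * exp (- (x s - y j) / \<epsilon>)"
    by (simp add: exp_add[symmetric] add_divide_distrib[symmetric])
  also have "exp (- (x s - y j) / \<epsilon>) = lower_block N \<epsilon> x y $$ (s - 1, j - 1)"
    using lower_block_entry[OF assms(2) _ j] assms(3-5,7) by auto
  finally show ?thesis
    using prod_ratio_vec_lower_block[OF assms(1-5)] assms(6,7) by simp
qed

theorem theorem2p2: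
  fixes N :: nat and \<epsilon> :: real and x y :: "nat \<Rightarrow> real"
    and \<zeta> :: "nat \<Rightarrow> nat" and K\<^sub>L :: "real mat" and r :: "nat \<Rightarrow> real" and \<eta> :: "nat \<Rightarrow> real vec"
  assumes "N \<ge> 1" and "\<epsilon> > 0"
    and "strict_mono_on {1..N} x" and "strict_mono_on {1..N} y"
  defines "\<zeta> \<equiv> dividing_index N x y"
    and "K\<^sub>L \<equiv> lower_block N \<epsilon> x y"
    and "r \<equiv> (\<lambda>i. ratio_vec K\<^sub>L $ (i - 1))"
    and "\<eta> \<equiv> block_edge K\<^sub>L \<zeta>"
  shows "(\<Sum>i = 1..N. dim_vec (\<eta> i)) = \<zeta> N
    \<and> (\<forall>i\<in>{1..N}. \<forall>s\<in>{1..N}.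
         row_segment K\<^sub>L i (\<zeta> (s - 1)) (\<zeta> s) =
           (if s \<le> i then (\<Prod>t = s..<i. r t) \<cdot>\<^sub>v \<eta> s else 0\<^sub>v (\<zeta> s - \<zeta> (s - 1))))
    \<and> (\<forall>j\<in>{\<zeta> N + 1..N}. col K\<^sub>L (j - 1) = 0\<^sub>v N)"
proof (intro conjI ballI)
  have mono: "\<zeta> i \<le> \<zeta> j" if "i \<le> j" "j \<le> N" for i j
    using dividing_index_mono[OF assms(3,4) that] by (simp add: \<zeta>_def)
  have le_N: "\<zeta> i \<le> N" for i
    using dividing_index_le[OF assms(4,1)] by (simp add: \<zeta>_def)
  have zero: "K\<^sub>L $$ (i - 1, j - 1) = 0" if "i \<in> {1..N}" "j \<in> {1..N}" "\<zeta> i < j" for i j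
    using lower_block_entry[OF assms(4) that(1,2)] that(3) by (simp add: K\<^sub>L_def \<zeta>_def)

  \<comment> \<open>Generalised to \<open>n\<close> for the induction; the sum starts from the
    convention \<open>\<zeta> 0 = 0\<close>, and monotonicity makes each truncated subtraction
    exact.\<close>
  have "(\<Sum>i = 1..n. dim_vec (\<eta> i)) = \<zeta> n" if "n \<le> N" for n
    using that
  proof (induction n)
    case 0
    then show ?case by (simp add: \<zeta>_def dividing_index_def)
  next
    case (Suc n)
    then show ?case
      using mono[of n "Suc n"] by (simp add: \<eta>_def block_edge_def row_segment_def)
  qed
  then show "(\<Sum>i = 1..N. dim_vec (\<eta> i)) = \<zeta> N" by simp

  show "row_segment K\<^sub>L i (\<zeta> (s - 1)) (\<zeta> s) =
      (if s \<le> i then (\<Prod>t = s..<i. r t) \<cdot>\<^sub>v \<eta> s else 0\<^sub>v (\<zeta> s - \<zeta> (s - 1)))"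
    if i: "i \<in> {1..N}" and s: "s \<in> {1..N}" for i s
  proof (cases "s \<le> i")
    case True
    \<comment> \<open>The offset \<open>c\<close> starts at 0, so the column counted from 1 is
      \<open>\<zeta> (s - 1) + c + 1\<close>, which is at most \<open>\<zeta> s\<close>. An empty
      block admits no \<open>c\<close>, so \<open>\<zeta> s\<close> is positive here.\<close>
    have "K\<^sub>L $$ (i - 1, \<zeta> (s - 1) + c) = (\<Prod>t = s..<i. r t) * K\<^sub>L $$ (s - 1, \<zeta> (s - 1) + c)"
      if "c < \<zeta> s - \<zeta> (s - 1)" for c
      using lower_block_entry_eq_prod_ratio[OF assms(3,4) _ True, of "\<zeta> (s - 1) + c + 1" \<epsilon>] i s that
      by (simp add: K\<^sub>L_def r_def \<zeta>_def)
    with True show ?thesis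
      by (auto simp: \<eta>_def block_edge_def row_segment_def)
  next
    case False
    \<comment> \<open>From \<open>i \<le> s - 1\<close>: block \<open>s\<close> starts only after
      the support of row \<open>i\<close> has ended.\<close>
    then have "\<zeta> i \<le> \<zeta> (s - 1)" using s by (intro mono) auto
    then have "K\<^sub>L $$ (i - 1, \<zeta> (s - 1) + c) = 0" if "c < \<zeta> s - \<zeta> (s - 1)" for c
      using zero[OF i, of "\<zeta> (s - 1) + c + 1"] le_N[of s] that by simp
    with False show ?thesis
      by (auto simp: row_segment_def)
  qed

  show "col K\<^sub>L (j - 1) = 0\<^sub>v N" if j: "j \<in> {\<zeta> N + 1..N}" for j
  proof (rule eq_vecI)
    have dim: "dim_row K\<^sub>L = N" "dim_col K\<^sub>L = N" by (simp_all add: K\<^sub>L_def lower_block_def)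
    then show "dim_vec (col K\<^sub>L (j - 1)) = dim_vec (0\<^sub>v N :: real vec)" by simp
    fix i assume "i < dim_vec (0\<^sub>v N :: real vec)"
    moreover have "j - 1 < N" using j by auto
    \<comment> \<open>Position \<open>i\<close> of the column belongs to row \<open>Suc i\<close>
      counted from 1, whose support ends by \<open>\<zeta> N < j\<close>.\<close>
    ultimately show "col K\<^sub>L (j - 1) $ i = 0\<^sub>v N $ i"
      using zero[of "Suc i" j] mono[of "Suc i" N] j dim by simp
  qed
qed

end
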